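(* Let $\varepsilon>0$, let $f\in L^2(\Omega)$ be supported in $\Sigma_{2\varepsilon}$, and let $g\in L^2_{per}(Y)$. Then $$\Big(\int_{\Sigma_{2\varepsilon}}|g(x/\varepsilon)S_\varepsilon(f)(x)|^2\,\delta^{-1}(x)\,dx\Big)^{1/2}\le C\|g\|_{L^2(Y)}\Big(\int_{\Sigma_{2\varepsilon}}|f(x)|^2\,\delta^{-1}(x)\,dx\Big)^{1/2}$$ and $$\Big(\int_{\Sigma_{2\varepsilon}}|g(x/\varepsilon)S_\varepsilon(f)(x)|^2\,\delta(x)\,dx\Big)^{1/2}\le C\|g\|_{L^2(Y)}\Big(\int_{\Sigma_{2\varepsilon}}|f(x)|^2\,\delta(x)\,dx\Big)^{1/2},$$ where $C$ depends only on $d$ and $\|\zeta\|_{L^\infty(B(0,1/2))}$.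
   Context: $\Omega\subset\mathbb{R}^d$, $d\ge3$, is a bounded Lipschitz domain; $\delta(x)=\mathrm{dist}(x,\partial\Omega)$ for $x\in\Omega$ and $\delta(x)=0$ for $x\in\mathbb{R}^d\setminus\Omega$; $\Sigma_r=\{x\in\Omega:\mathrm{dist}(x,\partial\Omega)>r\}$ for $r>0$. $Y=(0,1]^d$ and $L^2_{per}(Y)$ is the space of $\mathbb{Z}^d$-periodic functions on $\mathbb{R}^d$ that are square integrable on $Y$. A function $\zeta\in C_0^\infty(B(0,1/2))$ with $\int_{\mathbb{R}^d}\zeta=1$ is fixed, $\zeta_\varepsilon(x)=\varepsilon^{-d}\zeta(x/\varepsilon)$, and $S_\varepsilon(f)(x)=\int_{\mathbb{R}^d}f(x-y)\zeta_\varepsilon(y)\,dy$, where $f$ is extended by zero outside $\Omega$. *)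

theory Defs
  imports "HOL-Analysis.Analysis" "HOL-Probability.Essential_Supremum"
begin

text \<open>
  The domain. Near a boundary point \<open>x0\<close> we use coordinates with last axis along a unit vector
  \<open>e\<close>: a point \<open>x\<close> has last coordinate \<open>x \<bullet> e\<close> and its remaining coordinates are given by the
  projection \<open>x - (x \<bullet> e) *\<^sub>R e\<close> onto the hyperplane orthogonal to \<open>e\<close>. So \<open>\<phi>\<close> plays the role of a
  Lipschitz function of \<open>d - 1\<close> variables, and only its values on that hyperplane matter.
\<close>

definition lipschitz_boundary :: "'a::euclidean_space set \<Rightarrow> bool" where
  "lipschitz_boundary \<Omega> \<longleftrightarrow>
     (\<forall>x0 \<in> frontier \<Omega>. \<exists>r>0. \<exists>e. norm e = 1 \<and>
        (\<exists>\<phi> :: 'a \<Rightarrow> real. (\<exists>L. L-lipschitz_on {v. v \<bullet> e = 0} \<phi>) \<and>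
           \<Omega> \<inter> ball x0 r = {x \<in> ball x0 r. \<phi> (x - (x \<bullet> e) *\<^sub>R e) < x \<bullet> e}))"

definition bounded_lipschitz_domain :: "'a::euclidean_space set \<Rightarrow> bool" where
  "bounded_lipschitz_domain \<Omega> \<longleftrightarrow>
     open \<Omega> \<and> connected \<Omega> \<and> \<Omega> \<noteq> {} \<and> bounded \<Omega> \<and> lipschitz_boundary \<Omega>"

definition bdist :: "'a::euclidean_space set \<Rightarrow> 'a \<Rightarrow> real" where
  "bdist \<Omega> x = (if x \<in> \<Omega> then infdist x (frontier \<Omega>) else 0)"

definition inner_region :: "'a::euclidean_space set \<Rightarrow> real \<Rightarrow> 'a set" where
  "inner_region \<Omega> r = {x \<in> \<Omega>. infdist x (frontier \<Omega>) > r}"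

text \<open>Functions are taken instead of classes modulo null sets.\<close>

definition L2_on :: "'a::euclidean_space set \<Rightarrow> ('a \<Rightarrow> real) set" where
  "L2_on S = {f. f \<in> borel_measurable (lebesgue_on S) \<and> set_integrable lebesgue S (\<lambda>x. (f x)\<^sup>2)}"

definition L2_norm :: "'a::euclidean_space set \<Rightarrow> ('a \<Rightarrow> real) \<Rightarrow> real" where
  "L2_norm S f = sqrt (LINT x:S|lebesgue. (f x)\<^sup>2)"

definition unit_cell :: "(real ^ 'n) set" where
  "unit_cell = {x. \<forall>i. 0 < x $ i \<and> x $ i \<le> 1}"

definition L2_per :: "(real ^ 'n \<Rightarrow> real) set" where
  "L2_per = {g. g \<in> borel_measurable lebesgue \<and>
               (\<forall>z. (\<forall>i. z $ i \<in> \<int>) \<longrightarrow> (\<forall>x. g (x + z) = g x)) \<and>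
               g \<in> L2_on unit_cell}"

primrec C_diff :: "nat \<Rightarrow> ('a::euclidean_space \<Rightarrow> real) \<Rightarrow> bool" where
  "C_diff 0 f \<longleftrightarrow> continuous_on UNIV f"
| "C_diff (Suc k) f \<longleftrightarrow> (\<forall>x. f differentiable at x) \<and>
     (\<forall>b\<in>Basis. C_diff k (\<lambda>x. frechet_derivative f (at x) b))"

text \<open>\<open>C\<^sub>0\<^sup>\<infinity>(U)\<close>: smooth functions on the whole space whose (compact) support lies in \<open>U\<close>.\<close>

definition test_functions :: "'a::euclidean_space set \<Rightarrow> ('a \<Rightarrow> real) set" where
  "test_functions U = {f. (\<forall>k. C_diff k f) \<and>
     compact (closure {x. f x \<noteq> 0}) \<and> closure {x. f x \<noteq> 0} \<subseteq> U}"

definition Linf_norm :: "'a::euclidean_space set \<Rightarrow> ('a \<Rightarrow> real) \<Rightarrow> ereal" where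
  "Linf_norm S f = esssup (lebesgue_on S) (\<lambda>x. ereal \<bar>f x\<bar>)"

definition mollifier_scaled :: "(real ^ 'n \<Rightarrow> real) \<Rightarrow> real \<Rightarrow> real ^ 'n \<Rightarrow> real" where
  "mollifier_scaled \<zeta> \<epsilon> x = \<zeta> (x /\<^sub>R \<epsilon>) / \<epsilon> ^ CARD('n)"

definition extend_by_zero :: "'a set \<Rightarrow> ('a \<Rightarrow> real) \<Rightarrow> 'a \<Rightarrow> real" where
  "extend_by_zero \<Omega> f x = (if x \<in> \<Omega> then f x else 0)"

definition smoothing ::
  "(real ^ 'n) set \<Rightarrow> (real ^ 'n \<Rightarrow> real) \<Rightarrow> real \<Rightarrow> (real ^ 'n \<Rightarrow> real) \<Rightarrow> real ^ 'n \<Rightarrow> real" where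
  "smoothing \<Omega> \<zeta> \<epsilon> f x =
     (LINT y|lebesgue. extend_by_zero \<Omega> f (x - y) * mollifier_scaled \<zeta> \<epsilon> y)"

end

theory Submission
  imports Defs
begin

text \<open>
  For \<open>x\<close> in the inner region the ball \<open>B(x, \<epsilon>/2)\<close> stays in \<open>\<Omega>\<close> and the weight \<open>\<delta>\<close> (or \<open>1/\<delta>\<close>) changes on it
  by a factor at most \<open>2\<close>. Cauchy-Schwarz on that ball bounds \<open>|S f(x)|\<^sup>2 w(x)\<close> by
  \<open>2 M\<^sup>2 \<epsilon>\<^sup>-\<^sup>d\<close> times the integral of \<open>f\<^sup>2 w\<close> over \<open>B(x, \<epsilon>/2)\<close>. After multiplying by \<open>|g(x/\<epsilon>)|\<^sup>2\<close> and
  exchanging the integrals, the inner one is the integral of \<open>|g(x/\<epsilon>)|\<^sup>2\<close> over a ball of radius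
  \<open>\<epsilon>/2\<close>; after rescaling, that ball is covered by \<open>3\<^sup>d\<close> integer translates of the unit cell.
  Since \<open>f\<close> and \<open>g\<close> are only Lebesgue measurable, Tonelli is applied to Borel representatives.
\<close>

section \<open>Local averages in weighted \<open>L\<^sup>2\<close>\<close>

text \<open>The analytic core, with values in \<open>ennreal\<close> so that integrals may be
  exchanged before anything is known to be finite. The constant records the steps:
  \<open>c\<^sup>2\<close> from squaring the bound on \<open>T\<close>, \<open>V\<close> from
  Cauchy-Schwarz, \<open>K\<close> from moving the weight from \<open>x\<close> to \<open>z\<close>,
  and \<open>A\<close> from the integral of \<open>G\<close> that is left after the
  exchange.\<close>

lemma weighted_local_average_bound:
  fixes h G w T :: "'a::euclidean_space \<Rightarrow> ennreal"
  assumes [measurable]: "h \<in> borel_measurable borel" "G \<in> borel_measurable borel"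
    "w \<in> borel_measurable borel" "S \<in> sets borel"
  assumes G: "\<And>z. (\<integral>\<^sup>+x\<in>ball z r. G x \<partial>lborel) \<le> A"
    and V: "\<And>x::'a. emeasure lborel (ball x r) \<le> V"
    and w: "\<And>x z. x \<in> S \<Longrightarrow> z \<in> ball x r \<Longrightarrow> w x \<le> K * w z"
    and T: "\<And>x. x \<in> S \<Longrightarrow> T x \<le> c * (\<integral>\<^sup>+z\<in>ball x r. h z \<partial>lborel)"
  shows "(\<integral>\<^sup>+x\<in>S. G x * (T x)\<^sup>2 * w x \<partial>lborel) \<le> c\<^sup>2 * V * K * A * (\<integral>\<^sup>+z. (h z)\<^sup>2 * w z \<partial>lborel)"
proof -
  define I where "I x z = (indicator (ball x r) z :: ennreal)" for x z :: 'a
  \<comment> \<open>After the exchange, this symmetry turns the ball around \<open>x\<close> into a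
    ball around \<open>z\<close>, to which the hypothesis \<open>G\<close> applies.\<close>
  have I_sym: "I x z = I z x" for x z
    by (simp add: I_def indicator_def dist_commute)
  have I_meas: "(\<lambda>p. I (fst p) (snd p)) \<in> borel_measurable (borel \<Otimes>\<^sub>M borel)"
  proof -
    \<comment> \<open>Joint measurability, which Tonelli needs: the pairs at distance below
      \<open>r\<close> form an open set in the product.\<close>
    have "open {p::'a \<times> 'a. dist (fst p) (snd p) < r}"
      by (intro open_Collect_less continuous_intros)
    then have "{p::'a \<times> 'a. dist (fst p) (snd p) < r} \<in> sets (borel \<Otimes>\<^sub>M borel)"
      unfolding borel_prod by (rule borel_open)
    then have "(indicator {p::'a \<times> 'a. dist (fst p) (snd p) < r} :: _ \<Rightarrow> ennreal) \<in> borel_measurable (borel \<Otimes>\<^sub>M borel)"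
      by simp
    then show ?thesis
      by (rule measurable_cong[THEN iffD1, rotated]) (simp add: I_def indicator_def)
  qed
  then have [measurable]: "case_prod I \<in> borel_measurable (borel \<Otimes>\<^sub>M borel)"
    by (simp add: split_beta')
  have [measurable]: "I x \<in> borel_measurable borel" for x
    unfolding I_def by (intro borel_measurable_indicator borel_open open_ball)
  have CS: "(\<integral>\<^sup>+z. h z * I x z \<partial>lborel)\<^sup>2 \<le> V * (\<integral>\<^sup>+z. (h z)\<^sup>2 * I x z \<partial>lborel)" for x
  proof -
    have I2: "(I x z)\<^sup>2 = I x z" for z
      by (simp add: I_def indicator_def)
    \<comment> \<open>An indicator equals its square, so it can be split into two copies: one
      localises \<open>h\<close>, the other integrates to the volume of the ball.\<close>
    have "(\<integral>\<^sup>+z. h z * I x z \<partial>lborel)\<^sup>2 = (\<integral>\<^sup>+z. (h z * I x z) * I x z \<partial>lborel)\<^sup>2"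
      by (simp add: mult.assoc flip: power2_eq_square) (simp add: I2)
    also have "\<dots> \<le> (\<integral>\<^sup>+z. (h z * I x z)\<^sup>2 \<partial>lborel) * (\<integral>\<^sup>+z. (I x z)\<^sup>2 \<partial>lborel)"
      by (rule Cauchy_Schwarz_nn_integral) simp_all
    also have "(\<integral>\<^sup>+z. (I x z)\<^sup>2 \<partial>lborel) = emeasure lborel (ball x r)"
      unfolding I2 by (simp add: I_def)
    also have "(\<integral>\<^sup>+z. (h z * I x z)\<^sup>2 \<partial>lborel) * \<dots> \<le> (\<integral>\<^sup>+z. (h z)\<^sup>2 * I x z \<partial>lborel) * V"
      by (intro mult_mono V) (simp_all add: power_mult_distrib I2)
    finally show ?thesis by (simp add: mult.commute)
  qed
  \<comment> \<open>All factors are moved under the integral in \<open>z\<close>, which leaves one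
    jointly measurable integrand. The indicator of \<open>S\<close> is dropped on the right, where
    everything is nonnegative.\<close>
  have pointwise: "G x * (T x)\<^sup>2 * w x * indicator S x \<le>
      (\<integral>\<^sup>+z. c\<^sup>2 * V * K * (G x * (I x z * ((h z)\<^sup>2 * w z))) \<partial>lborel)" for x
  proof (cases "x \<in> S")
    case True
    have "(T x)\<^sup>2 * w x \<le> (c * (\<integral>\<^sup>+z. h z * I x z \<partial>lborel))\<^sup>2 * w x"
      using T[OF True] by (intro mult_right_mono power_mono) (simp_all add: I_def)
    also have "\<dots> \<le> c\<^sup>2 * (V * (\<integral>\<^sup>+z. (h z)\<^sup>2 * I x z \<partial>lborel)) * w x"
      by (intro mult_right_mono) (simp_all add: power_mult_distrib CS mult_left_mono)
    also have "\<dots> = c\<^sup>2 * V * (\<integral>\<^sup>+z. (h z)\<^sup>2 * I x z * w x \<partial>lborel)"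
      by (subst nn_integral_multc) (simp_all add: mult_ac)
    also have "\<dots> \<le> c\<^sup>2 * V * (\<integral>\<^sup>+z. K * (I x z * ((h z)\<^sup>2 * w z)) \<partial>lborel)"
    proof (intro mult_left_mono nn_integral_mono)
      fix z
      show "(h z)\<^sup>2 * I x z * w x \<le> K * (I x z * ((h z)\<^sup>2 * w z))"
      proof (cases "z \<in> ball x r")
        case z: True
        have "(h z)\<^sup>2 * w x \<le> (h z)\<^sup>2 * (K * w z)"
          by (intro mult_left_mono w True z) simp
        with z show ?thesis by (simp add: I_def mult_ac)
      qed (simp add: I_def)
    qed simp
    finally have "G x * ((T x)\<^sup>2 * w x) \<le> G x * (c\<^sup>2 * V * (\<integral>\<^sup>+z. K * (I x z * ((h z)\<^sup>2 * w z)) \<partial>lborel))"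
      by (rule mult_left_mono) simp
    also have "\<dots> = (\<integral>\<^sup>+z. c\<^sup>2 * V * K * (G x * (I x z * ((h z)\<^sup>2 * w z))) \<partial>lborel)"
      by (subst nn_integral_cmult, measurable)+ (simp only: mult_ac)
    finally show ?thesis using True by (simp add: mult_ac)
  qed simp
  have "(\<integral>\<^sup>+x\<in>S. G x * (T x)\<^sup>2 * w x \<partial>lborel) \<le>
      (\<integral>\<^sup>+x. (\<integral>\<^sup>+z. c\<^sup>2 * V * K * (G x * (I x z * ((h z)\<^sup>2 * w z))) \<partial>lborel) \<partial>lborel)"
    by (intro nn_integral_mono pointwise)
  also have "\<dots> = (\<integral>\<^sup>+z. (\<integral>\<^sup>+x. c\<^sup>2 * V * K * (G x * (I x z * ((h z)\<^sup>2 * w z))) \<partial>lborel) \<partial>lborel)"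
    by (rule lborel_pair.Fubini') simp
  also have "\<dots> = (\<integral>\<^sup>+z. c\<^sup>2 * V * K * ((h z)\<^sup>2 * w z) * (\<integral>\<^sup>+x. G x * I z x \<partial>lborel) \<partial>lborel)"
    by (intro nn_integral_cong, subst nn_integral_cmult[symmetric]) (simp_all add: I_sym mult_ac)
  also have "\<dots> \<le> (\<integral>\<^sup>+z. c\<^sup>2 * V * K * ((h z)\<^sup>2 * w z) * A \<partial>lborel)"
    using G by (intro nn_integral_mono mult_left_mono) (simp_all add: I_def)
  also have "\<dots> = (\<integral>\<^sup>+z. c\<^sup>2 * V * K * A * ((h z)\<^sup>2 * w z) \<partial>lborel)"
    by (simp add: mult_ac)
  also have "\<dots> = c\<^sup>2 * V * K * A * (\<integral>\<^sup>+z. (h z)\<^sup>2 * w z \<partial>lborel)"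
    by (rule nn_integral_cmult) simp
  finally show ?thesis .
qed

section \<open>Affine changes of variables for Lebesgue measurable functions\<close>

text \<open>Both facts are the library formula for coordinatewise affine maps, taken with the same
  factor in every coordinate. Negative \<open>c\<close> matters: \<open>c = 1\<close> serves lattice
  translations, \<open>c = -1\<close> the reflection \<open>y \<mapsto> x - y\<close> of the
  convolution, and \<open>\<epsilon>\<close> and its inverse the rescaling.\<close>

lemma
  fixes t :: "'a::euclidean_space" and c :: real
  assumes c: "c \<noteq> 0"
  shows lebesgue_measurable_translate_scale: "(\<lambda>x. t + c *\<^sub>R x) \<in> lebesgue \<rightarrow>\<^sub>M lebesgue"
    and nn_integral_lebesgue_translate_scale: "f \<in> borel_measurable lebesgue \<Longrightarrow>
      (\<integral>\<^sup>+x. f x \<partial>lebesgue) = ennreal (\<bar>c\<bar> ^ DIM('a)) * (\<integral>\<^sup>+x. f (t + c *\<^sub>R x) \<partial>lebesgue)"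
proof -
  have T: "(\<lambda>x. t + (\<Sum>j\<in>Basis. (c * (x \<bullet> j)) *\<^sub>R j)) = (\<lambda>x. t + c *\<^sub>R x)"
    by (simp add: fun_eq_iff euclidean_representation flip: scaleR_scaleR scaleR_sum_right)
  show m: "(\<lambda>x. t + c *\<^sub>R x) \<in> lebesgue \<rightarrow>\<^sub>M lebesgue"
    using lebesgue_affine_measurable[of "\<lambda>_. c" t] c unfolding T by simp
  assume f: "f \<in> borel_measurable lebesgue"
  have eq: "lebesgue = density (distr lebesgue lebesgue (\<lambda>x. t + c *\<^sub>R x)) (\<lambda>_. (\<Prod>j\<in>(Basis::'a set). \<bar>c\<bar>))"
    using lebesgue_affine_euclidean[of "\<lambda>_. c" t] c unfolding T by simp
  show "(\<integral>\<^sup>+x. f x \<partial>lebesgue) = ennreal (\<bar>c\<bar> ^ DIM('a)) * (\<integral>\<^sup>+x. f (t + c *\<^sub>R x) \<partial>lebesgue)"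
    using f m by (subst eq) (simp add: nn_integral_density nn_integral_distr nn_integral_cmult del: space_completion)
qed

text \<open>The preimage of a null set is null: the change of variables for its indicator gives a
  zero integral times the nonzero factor \<open>\<bar>c\<bar> ^ DIM('a)\<close>.\<close>

lemma AE_lebesgue_translate_scale:
  fixes t :: "'a::euclidean_space" and c :: real
  assumes c: "c \<noteq> 0" and P: "AE x in lebesgue. P x"
  shows "AE x in lebesgue. P (t + c *\<^sub>R x)"
proof -
  obtain N where N: "{x \<in> space lebesgue. \<not> P x} \<subseteq> N" "emeasure lebesgue N = 0" "N \<in> sets lebesgue"
    using P by (rule AE_E)
  have "ennreal (\<bar>c\<bar> ^ DIM('a)) * (\<integral>\<^sup>+x. indicator N (t + c *\<^sub>R x) \<partial>lebesgue) = 0"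
    using nn_integral_lebesgue_translate_scale[OF c, of "indicator N" t] N by simp
  then have "(\<integral>\<^sup>+x. indicator N (t + c *\<^sub>R x) \<partial>lebesgue) = (0::ennreal)"
    using c by (simp add: not_le)
  moreover have "(\<lambda>x. indicator N (t + c *\<^sub>R x) :: ennreal) \<in> borel_measurable lebesgue"
    using N lebesgue_measurable_translate_scale[OF c, of t] by (auto intro: measurable_compose)
  ultimately have "AE x in lebesgue. indicator N (t + c *\<^sub>R x) = (0::ennreal)"
    by (subst (asm) nn_integral_0_iff_AE)
  then show ?thesis
    by (rule eventually_mono) (use N(1) in \<open>auto simp: indicator_def split: if_splits\<close>)
qed

section \<open>Periodic functions on small balls\<close>

lemma unit_cell_borel: "(unit_cell :: (real ^ 'n) set) \<in> sets borel"
proof -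
  have "(unit_cell :: (real ^ 'n) set) = (\<Inter>i. {x. 0 < x $ i} \<inter> {x. x $ i \<le> 1})"
    by (auto simp: unit_cell_def)
  also have "\<dots> \<in> sets borel"
    by (intro sets.finite_INT sets.Int borel_open borel_closed open_Collect_less closed_Collect_le continuous_intros) auto
  finally show ?thesis .
qed

text \<open>Points of the ball differ from \<open>a\<close> by less than 1/2 in each coordinate, so
  their cells are offset from the integer vector below \<open>a\<close> by -1, 0 or 1 per
  coordinate. This leaves at most \<open>3 ^ CARD('n)\<close> cells, and periodicity makes their
  integrals equal.\<close>

lemma nn_integral_periodic_ball_le:
  fixes G :: "real ^ 'n \<Rightarrow> ennreal"
  assumes G: "G \<in> borel_measurable lebesgue"
    and per: "\<And>z x. (\<And>i. z $ i \<in> \<int>) \<Longrightarrow> G (x + z) = G x"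
  shows "(\<integral>\<^sup>+x\<in>ball a (1/2). G x \<partial>lebesgue) \<le> 3 ^ CARD('n) * (\<integral>\<^sup>+x\<in>unit_cell. G x \<partial>lebesgue)"
proof -
  define D where "D = {-1, 0, 1 :: real}"
  define E where "E = {e :: real ^ 'n. \<forall>i. e $ i \<in> D}"
  define k :: "real ^ 'n" where "k = (\<chi> i. of_int \<lfloor>a $ i\<rfloor>)"
  let ?Q = "unit_cell :: (real ^ 'n) set"
  have E: "finite E" "card E \<le> 3 ^ CARD('n)"
  proof -
    have "E \<subseteq> vec_lambda ` (UNIV \<rightarrow>\<^sub>E D)"
    proof
      fix e assume "e \<in> E"
      then have "vec_nth e \<in> UNIV \<rightarrow>\<^sub>E D" by (auto simp: E_def PiE_UNIV_domain)
      then have "vec_lambda (vec_nth e) \<in> vec_lambda ` (UNIV \<rightarrow>\<^sub>E D)" by (rule imageI)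
      then show "e \<in> vec_lambda ` (UNIV \<rightarrow>\<^sub>E D)" by simp
    qed
    moreover have fin: "finite ((UNIV :: 'n set) \<rightarrow>\<^sub>E D)"
      by (rule finite_PiE) (simp_all add: D_def)
    moreover have "card ((UNIV :: 'n set) \<rightarrow>\<^sub>E D) = 3 ^ CARD('n)"
      by (simp add: card_PiE D_def numeral_3_eq_3)
    ultimately show "finite E" "card E \<le> 3 ^ CARD('n)"
      using card_mono[of "vec_lambda ` (UNIV \<rightarrow>\<^sub>E D)" E] card_image_le[OF fin, of vec_lambda]
      by (auto intro: finite_subset)
  qed
  have int: "(k + e) $ i \<in> \<int>" if "e \<in> E" for e i
    using that by (auto simp: E_def D_def k_def dest!: spec[of _ i])
  have cover: "indicator (ball a (1/2)) x \<le> (\<Sum>e\<in>E. indicator ?Q (x - (k + e)) :: ennreal)" for x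
  proof (cases "x \<in> ball a (1/2)")
    case True
    \<comment> \<open>The cell is open on the left and closed on the right, so the lower corner of
      the translate containing \<open>x\<close> is the ceiling minus 1, not the floor. Subtracting
      \<open>k\<close> gives the offset.\<close>
    define e :: "real ^ 'n" where "e = (\<chi> i. of_int (\<lceil>x $ i\<rceil> - 1 - \<lfloor>a $ i\<rfloor>))"
    have "\<lceil>x $ i\<rceil> - 1 - \<lfloor>a $ i\<rfloor> \<in> {-1, 0, 1}" for i
    proof -
      have "\<bar>a $ i - x $ i\<bar> < 1/2"
        using component_le_norm_cart[of "a - x" i] True by (simp add: dist_norm)
      then have "- 2 < real_of_int (\<lceil>x $ i\<rceil> - 1 - \<lfloor>a $ i\<rfloor>)" "real_of_int (\<lceil>x $ i\<rceil> - 1 - \<lfloor>a $ i\<rfloor>) < 2"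
        using ceiling_correct[of "x $ i"] floor_correct[of "a $ i"]
        unfolding of_int_diff of_int_add of_int_1 abs_less_iff by linarith+
      then have "- 2 < \<lceil>x $ i\<rceil> - 1 - \<lfloor>a $ i\<rfloor>" "\<lceil>x $ i\<rceil> - 1 - \<lfloor>a $ i\<rfloor> < 2"
        by linarith+
      then show ?thesis by auto
    qed
    moreover have "real_of_int m \<in> D" if "m \<in> {-1, 0, 1}" for m
      using that by (auto simp: D_def)
    ultimately have "real_of_int (\<lceil>x $ i\<rceil> - 1 - \<lfloor>a $ i\<rfloor>) \<in> D" for i
      by blast
    then have "e \<in> E"
      by (simp add: E_def e_def del: of_int_diff)
    have "0 < (x - (k + e)) $ i \<and> (x - (k + e)) $ i \<le> 1" for i
      using ceiling_correct[of "x $ i"] by (simp add: k_def e_def)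
    then have "x - (k + e) \<in> ?Q"
      by (simp add: unit_cell_def)
    then have "1 \<le> (indicator ?Q (x - (k + e)) :: ennreal)"
      by simp
    also have "\<dots> \<le> (\<Sum>e\<in>E. indicator ?Q (x - (k + e)))"
      by (rule member_le_sum) (use \<open>e \<in> E\<close> E in auto)
    finally show ?thesis using True by simp
  qed simp
  have Q: "?Q \<in> sets lebesgue"
    using unit_cell_borel by (intro sets_completionI_sets) simp
  have Qm: "(\<lambda>x. indicator ?Q (x - m) :: ennreal) \<in> borel_measurable lebesgue" for m
    using measurable_compose[OF lebesgue_measurable_translate_scale[of 1 "- m"] borel_measurable_indicator[OF Q]] by simp
  \<comment> \<open>Substituting \<open>x + (k + e)\<close> for \<open>x\<close> moves the cell back
    to \<open>?Q\<close>, and \<open>G\<close> is unchanged because \<open>k + e\<close> is an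
    integer vector.\<close>
  have cell: "(\<integral>\<^sup>+x. G x * indicator ?Q (x - (k + e)) \<partial>lebesgue) = (\<integral>\<^sup>+x\<in>?Q. G x \<partial>lebesgue)" if "e \<in> E" for e
    using per[OF int[OF that]] G Qm
    by (subst nn_integral_lebesgue_translate_scale[of 1 _ "k + e"]) (simp_all add: add.commute[of "k + e"])
  have "(\<integral>\<^sup>+x\<in>ball a (1/2). G x \<partial>lebesgue) \<le> (\<integral>\<^sup>+x. (\<Sum>e\<in>E. G x * indicator ?Q (x - (k + e))) \<partial>lebesgue)"
    by (intro nn_integral_mono) (auto simp flip: sum_distrib_left intro!: mult_left_mono cover)
  also have "\<dots> = (\<Sum>e\<in>E. \<integral>\<^sup>+x. G x * indicator ?Q (x - (k + e)) \<partial>lebesgue)"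
    using G Qm by (intro nn_integral_sum) simp
  also have "\<dots> = of_nat (card E) * (\<integral>\<^sup>+x\<in>?Q. G x \<partial>lebesgue)"
    by (simp add: cell)
  also have "\<dots> \<le> 3 ^ CARD('n) * (\<integral>\<^sup>+x\<in>?Q. G x \<partial>lebesgue)"
    using E(2) by (intro mult_right_mono) (simp_all flip: of_nat_le_iff[where 'a = ennreal])
  finally show ?thesis .
qed

text \<open>Rescaling by \<open>\<epsilon>\<close> reduces this to radius 1/2. The Jacobian
  \<open>\<epsilon> ^ CARD('n)\<close> is one of the two powers that later absorb the squared height
  of the scaled mollifier.\<close>

lemma nn_integral_periodic_scaled_ball_le:
  fixes G :: "real ^ 'n \<Rightarrow> ennreal"
  assumes G: "G \<in> borel_measurable lebesgue"
    and per: "\<And>z x. (\<And>i. z $ i \<in> \<int>) \<Longrightarrow> G (x + z) = G x"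
    and \<epsilon>: "\<epsilon> > 0"
  shows "(\<integral>\<^sup>+x\<in>ball a (\<epsilon> / 2). G (x /\<^sub>R \<epsilon>) \<partial>lebesgue) \<le>
    ennreal (\<epsilon> ^ CARD('n)) * (3 ^ CARD('n) * (\<integral>\<^sup>+x\<in>unit_cell. G x \<partial>lebesgue))"
proof -
  have m: "(\<lambda>x. G (x /\<^sub>R \<epsilon>)) \<in> borel_measurable lebesgue"
    using measurable_compose[OF lebesgue_measurable_translate_scale[of "inverse \<epsilon>" 0] G] \<epsilon> by simp
  have ball: "\<epsilon> *\<^sub>R x \<in> ball a (\<epsilon> / 2) \<longleftrightarrow> x \<in> ball (a /\<^sub>R \<epsilon>) (1/2)" for x
  proof -
    have "a - \<epsilon> *\<^sub>R x = \<epsilon> *\<^sub>R (a /\<^sub>R \<epsilon> - x)"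
      using \<epsilon> by (simp add: scaleR_diff_right)
    then have "dist a (\<epsilon> *\<^sub>R x) = \<epsilon> * dist (a /\<^sub>R \<epsilon>) x"
      using \<epsilon> by (simp add: dist_norm)
    then show ?thesis using \<epsilon> by (simp add: field_simps)
  qed
  have "(\<integral>\<^sup>+x\<in>ball a (\<epsilon> / 2). G (x /\<^sub>R \<epsilon>) \<partial>lebesgue) =
      ennreal (\<epsilon> ^ CARD('n)) * (\<integral>\<^sup>+x. G ((\<epsilon> *\<^sub>R x) /\<^sub>R \<epsilon>) * indicator (ball a (\<epsilon> / 2)) (\<epsilon> *\<^sub>R x) \<partial>lebesgue)"
    using \<epsilon> by (subst nn_integral_lebesgue_translate_scale[of \<epsilon> _ 0])
      (intro borel_measurable_times_ennreal m borel_measurable_indicator fmeasurableD[OF lmeasurable_ball] | simp)+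
  also have "(\<integral>\<^sup>+x. G ((\<epsilon> *\<^sub>R x) /\<^sub>R \<epsilon>) * indicator (ball a (\<epsilon> / 2)) (\<epsilon> *\<^sub>R x) \<partial>lebesgue) =
      (\<integral>\<^sup>+x\<in>ball (a /\<^sub>R \<epsilon>) (1/2). G x \<partial>lebesgue)"
    using \<epsilon> ball by (intro nn_integral_cong) (simp add: indicator_def)
  finally show ?thesis
    using nn_integral_periodic_ball_le[OF G per, of "a /\<^sub>R \<epsilon>"] by (simp add: mult_left_mono)
qed

section \<open>Balls of radius \<open>\<epsilon> / 2\<close> and the distance to the
  boundary\<close>

text \<open>The ball lies in a cube of side \<open>\<epsilon>\<close>, which avoids the exact volume
  of the unit ball.\<close>

lemma emeasure_lborel_half_ball_le:
  assumes "\<epsilon> > 0"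
  shows "emeasure lborel (ball (x :: 'a::euclidean_space) (\<epsilon> / 2)) \<le> ennreal (\<epsilon> ^ DIM('a))"
proof -
  let ?u = "(\<epsilon> / 2) *\<^sub>R (One :: 'a)"
  have "ball x (\<epsilon> / 2) \<subseteq> cbox (x - ?u) (x + ?u)"
  proof
    fix y assume "y \<in> ball x (\<epsilon> / 2)"
    then have "\<bar>x \<bullet> b - y \<bullet> b\<bar> \<le> \<epsilon> / 2" if "b \<in> Basis" for b
      using Basis_le_norm[OF that, of "x - y"] by (simp add: dist_norm inner_diff_left)
    then show "y \<in> cbox (x - ?u) (x + ?u)"
      by (simp add: mem_box inner_diff_left inner_add_left abs_le_iff) (smt (verit) field_sum_of_halves)
  qed
  then have "emeasure lborel (ball x (\<epsilon> / 2)) \<le> emeasure lborel (cbox (x - ?u) (x + ?u))"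
    by (intro emeasure_mono) auto
  also have "\<dots> = ennreal (\<epsilon> ^ DIM('a))"
    using assms by (subst emeasure_lborel_cbox) (auto simp: inner_diff_left inner_add_left)
  finally show ?thesis .
qed

text \<open>A ball is connected, so if it meets \<open>\<Omega>\<close> and also leaves it, then it
  contains a frontier point, closer to \<open>x\<close> than \<open>infdist\<close> allows.\<close>

lemma ball_subset_of_infdist_frontier:
  fixes x :: "'a::real_normed_vector"
  assumes "x \<in> \<Omega>" "r \<le> infdist x (frontier \<Omega>)"
  shows "ball x r \<subseteq> \<Omega>"
proof (rule ccontr)
  assume *: "\<not> ball x r \<subseteq> \<Omega>"
  then have "r > 0" by (metis ball_eq_empty empty_subsetI not_le)
  then have "ball x r \<inter> \<Omega> \<noteq> {}" using assms centre_in_ball[of x r] by blast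
  with * have "ball x r \<inter> frontier \<Omega> \<noteq> {}"
    by (intro connected_Int_frontier) auto
  then obtain y where "y \<in> frontier \<Omega>" "dist x y < r" by auto
  with infdist_le[of y "frontier \<Omega>" x] assms show False by simp
qed

text \<open>The distance to the frontier is 1-Lipschitz, so it changes by less than
  \<open>\<epsilon> / 2\<close> on the ball, under a quarter of its value at \<open>x\<close>. Since
  \<open>bdist\<close> drops to 0 outside \<open>\<Omega>\<close>, the point \<open>z\<close> must
  first be placed inside.\<close>

lemma bdist_comparable:
  assumes \<epsilon>: "\<epsilon> > 0" and x: "x \<in> inner_region \<Omega> (2 * \<epsilon>)" and z: "z \<in> ball x (\<epsilon> / 2)"
  shows "2 * \<epsilon> < bdist \<Omega> x" "bdist \<Omega> x \<le> 2 * bdist \<Omega> z" "bdist \<Omega> z \<le> 2 * bdist \<Omega> x"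
proof -
  have x': "x \<in> \<Omega>" "2 * \<epsilon> < infdist x (frontier \<Omega>)"
    using x by (auto simp: inner_region_def)
  then have "z \<in> \<Omega>"
    using ball_subset_of_infdist_frontier[of x \<Omega> "\<epsilon> / 2"] \<epsilon> z by auto
  then show "2 * \<epsilon> < bdist \<Omega> x" "bdist \<Omega> x \<le> 2 * bdist \<Omega> z" "bdist \<Omega> z \<le> 2 * bdist \<Omega> x"
    using infdist_triangle[of x "frontier \<Omega>" z] infdist_triangle[of z "frontier \<Omega>" x] x' z \<epsilon>
    by (auto simp: bdist_def dist_commute)
qed

lemma inner_region_borel: "open \<Omega> \<Longrightarrow> inner_region \<Omega> r \<in> sets borel"
proof -
  assume "open \<Omega>"
  then have "open (\<Omega> \<inter> {x. infdist x (frontier \<Omega>) > r})"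
    by (intro open_Int open_Collect_less continuous_intros)
  moreover have "\<Omega> \<inter> {x. infdist x (frontier \<Omega>) > r} = inner_region \<Omega> r"
    by (auto simp: inner_region_def)
  ultimately show ?thesis by simp
qed

lemma bdist_borel_measurable: "open \<Omega> \<Longrightarrow> bdist \<Omega> \<in> borel_measurable borel"
proof -
  assume "open \<Omega>"
  then have [measurable]: "\<Omega> \<in> sets borel" by simp
  have [measurable]: "(\<lambda>x. infdist x (frontier \<Omega>)) \<in> borel_measurable borel"
    by (intro borel_measurable_continuous_onI continuous_intros)
  show ?thesis unfolding bdist_def[abs_def] by measurable
qed

lemma bdist_bounded:
  assumes "bounded \<Omega>"
  obtains B where "\<And>x. bdist \<Omega> x \<le> B"
proof -
  obtain B where B: "\<And>x y. x \<in> closure \<Omega> \<Longrightarrow> y \<in> closure \<Omega> \<Longrightarrow> dist x y \<le> B"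
    using assms by (meson bounded_closure bounded_two_points)
  have "bdist \<Omega> x \<le> max 0 B" for x
  proof (cases "x \<in> \<Omega> \<and> frontier \<Omega> \<noteq> {}")
    case True
    then obtain y where "y \<in> frontier \<Omega>" by auto
    then have "infdist x (frontier \<Omega>) \<le> B"
      using True B[of x y] by (intro infdist_le2[of y]) (auto simp: frontier_def closure_subset[THEN subsetD])
    then show ?thesis using True by (simp add: bdist_def)
  \<comment> \<open>For an empty frontier \<open>infdist\<close> is 0 by convention.\<close>
  qed (auto simp: bdist_def infdist_def)
  then show ?thesis by (rule that)
qed

section \<open>The mollifier and the smoothing operator\<close>

text \<open>Makes the extended real norm usable as a real constant. It is finite because
  \<open>\<zeta>\<close> is continuous with compact support, and nonnegative because the integral of
  \<open>\<zeta>\<close> is nonzero.\<close>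

lemma test_function_Linf_bound:
  fixes \<zeta> :: "'a::euclidean_space \<Rightarrow> real"
  assumes \<zeta>: "\<zeta> \<in> test_functions U" and U: "open U" and nz: "(LINT x|lebesgue. \<zeta> x) \<noteq> 0"
  defines "M \<equiv> real_of_ereal (Linf_norm U \<zeta>)"
  shows "0 \<le> M" "AE x in lebesgue. \<bar>\<zeta> x\<bar> \<le> M * indicator U x" "\<zeta> \<in> borel_measurable borel"
proof -
  have "C_diff 0 \<zeta>" and comp: "compact (closure {x. \<zeta> x \<noteq> 0})" and sub: "closure {x. \<zeta> x \<noteq> 0} \<subseteq> U"
    using \<zeta> unfolding test_functions_def by blast+
  then have cont: "continuous_on UNIV \<zeta>" by simp
  then show meas: "\<zeta> \<in> borel_measurable borel" by (rule borel_measurable_continuous_onI)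
  have zero: "\<zeta> x = 0" if "x \<notin> U" for x
    using that sub closure_subset[of "{x. \<zeta> x \<noteq> 0}"] by blast
  have "compact (\<zeta> ` closure {x. \<zeta> x \<noteq> 0})"
    using cont comp by (meson compact_continuous_image continuous_on_subset subset_UNIV)
  then obtain B where "\<forall>x\<in>closure {x. \<zeta> x \<noteq> 0}. \<bar>\<zeta> x\<bar> \<le> B"
    by (auto dest!: compact_imp_bounded simp: bounded_iff)
  have B: "\<bar>\<zeta> x\<bar> \<le> max 0 B" for x
    using closure_subset[of "{x. \<zeta> x \<noteq> 0}"] \<open>\<forall>x\<in>_. _\<close> by (cases "\<zeta> x = 0") (auto simp: max.coboundedI2)
  have m: "(\<lambda>x. ereal \<bar>\<zeta> x\<bar>) \<in> borel_measurable (lebesgue_on U)"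
  proof -
    have "(\<lambda>x. ereal \<bar>\<zeta> x\<bar>) \<in> borel_measurable borel" using meas by measurable
    then show ?thesis by (intro measurable_restrict_space1 measurable_completion) simp
  qed
  have le: "Linf_norm U \<zeta> \<le> ereal (max 0 B)"
    unfolding Linf_norm_def by (rule esssup_I[OF m], rule AE_I2) (use B in \<open>simp only: ereal_less_eq\<close>)
  have AE: "AE x in lebesgue. x \<in> U \<longrightarrow> ereal \<bar>\<zeta> x\<bar> \<le> Linf_norm U \<zeta>"
    using esssup_AE[of "\<lambda>x. ereal \<bar>\<zeta> x\<bar>" "lebesgue_on U"] U
    by (subst (asm) AE_restrict_space_iff) (simp_all add: Linf_norm_def)
  \<comment> \<open>An essential supremum can be negative only over a null set: no point satisfies
    the bound then, so almost every point lies outside \<open>U\<close>, where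
    \<open>\<zeta>\<close> vanishes.\<close>
  have ge: "0 \<le> Linf_norm U \<zeta>"
  proof (rule ccontr)
    assume "\<not> 0 \<le> Linf_norm U \<zeta>"
    then have "\<not> ereal \<bar>\<zeta> x\<bar> \<le> Linf_norm U \<zeta>" for x
      by (meson abs_ge_zero ereal_less_eq(5) order_trans)
    with AE have "AE x in lebesgue. \<zeta> x = 0"
      by (auto elim!: eventually_mono intro: zero)
    then have "(LINT x|lebesgue. \<zeta> x) = 0"
      by (rule integral_eq_zero_AE)
    with nz show False by simp
  qed
  then show "0 \<le> M" unfolding M_def by (rule real_of_ereal_pos)
  have "Linf_norm U \<zeta> = ereal M"
    using le ge unfolding M_def by (intro ereal_real'[symmetric]) (auto simp: max_def split: if_splits)
  with AE show "AE x in lebesgue. \<bar>\<zeta> x\<bar> \<le> M * indicator U x"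
    by (auto elim!: eventually_mono simp: indicator_def zero)
qed

lemma extend_by_zero_measurable:
  fixes \<Omega> :: "'a::euclidean_space set"
  assumes \<Omega>: "open \<Omega>" and f: "f \<in> L2_on \<Omega>"
  shows "extend_by_zero \<Omega> f \<in> borel_measurable lebesgue"
proof -
  have "f \<in> borel_measurable (lebesgue_on \<Omega>)"
    using f by (simp add: L2_on_def)
  then have "(\<lambda>x. if x \<in> \<Omega> then f x else 0) \<in> borel_measurable lebesgue"
    using \<Omega> by (intro borel_measurable_if_I) auto
  then show ?thesis by (simp add: extend_by_zero_def[abs_def])
qed

lemma mollifier_scaled_measurable:
  assumes [measurable]: "\<zeta> \<in> borel_measurable borel"
  shows "mollifier_scaled \<zeta> \<epsilon> \<in> borel_measurable borel"
  unfolding mollifier_scaled_def[abs_def] by measurable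

text \<open>For each fixed \<open>x\<close> the reflection \<open>y \<mapsto> x - y\<close>
  preserves null sets, so passing to \<open>h\<close> leaves the convolution unchanged at every
  point, not only almost everywhere.\<close>

lemma smoothing_borel_representative:
  assumes \<Omega>: "open \<Omega>" and f: "f \<in> L2_on \<Omega>" and \<zeta>: "\<zeta> \<in> borel_measurable borel"
    and [measurable]: "h \<in> borel_measurable borel" and h: "AE x in lebesgue. extend_by_zero \<Omega> f x = h x"
  shows "smoothing \<Omega> \<zeta> \<epsilon> f x = (LINT y|lborel. h (x - y) * mollifier_scaled \<zeta> \<epsilon> y)"
proof -
  note [measurable] = mollifier_scaled_measurable[OF \<zeta>]
  have "AE y in lebesgue. extend_by_zero \<Omega> f (x - y) = h (x - y)"
    using AE_lebesgue_translate_scale[of "-1", OF _ h, of x] by simp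
  then have ae: "AE y in lebesgue. extend_by_zero \<Omega> f (x - y) * mollifier_scaled \<zeta> \<epsilon> y = h (x - y) * mollifier_scaled \<zeta> \<epsilon> y"
    by (rule eventually_mono) simp
  have hm: "(\<lambda>y. h (x - y) * mollifier_scaled \<zeta> \<epsilon> y) \<in> borel_measurable lborel"
    by measurable
  have "(\<lambda>y. extend_by_zero \<Omega> f (x - y)) \<in> borel_measurable lebesgue"
    using measurable_compose[OF lebesgue_measurable_translate_scale[of "-1" x] extend_by_zero_measurable[OF \<Omega> f]] by simp
  moreover have "mollifier_scaled \<zeta> \<epsilon> \<in> borel_measurable lebesgue"
    by (intro measurable_completion) simp
  ultimately have em: "(\<lambda>y. extend_by_zero \<Omega> f (x - y) * mollifier_scaled \<zeta> \<epsilon> y) \<in> borel_measurable lebesgue"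
    by (rule borel_measurable_times)
  show ?thesis
    unfolding smoothing_def
    by (subst integral_completion[OF hm, symmetric], rule integral_cong_AE[OF em measurable_completion[OF hm] ae])
qed

text \<open>With the Borel representative the integrand is jointly Borel in \<open>x\<close> and
  \<open>y\<close>, and an integral depending on a parameter is then Borel in it.\<close>

lemma smoothing_borel_measurable:
  assumes \<Omega>: "open \<Omega>" and f: "f \<in> L2_on \<Omega>" and \<zeta>: "\<zeta> \<in> borel_measurable borel"
  shows "smoothing \<Omega> \<zeta> \<epsilon> f \<in> borel_measurable borel"
proof -
  note [measurable] = mollifier_scaled_measurable[OF \<zeta>]
  obtain h where [measurable]: "h \<in> borel_measurable lborel" and h: "AE x in lborel. extend_by_zero \<Omega> f x = h x"
    using completion_ex_borel_measurable_real[OF extend_by_zero_measurable[OF \<Omega> f]] by auto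
  have "smoothing \<Omega> \<zeta> \<epsilon> f = (\<lambda>x. LINT y|lborel. h (x - y) * mollifier_scaled \<zeta> \<epsilon> y)"
    using h assms by (intro ext smoothing_borel_representative) (simp_all add: AE_completion_iff)
  moreover have "(\<lambda>x. LINT y|lborel. h (x - y) * mollifier_scaled \<zeta> \<epsilon> y) \<in> borel_measurable borel"
    by (rule lborel.borel_measurable_lebesgue_integral) measurable
  ultimately show ?thesis by simp
qed

text \<open>The scaled mollifier is almost everywhere at most
  \<open>M / \<epsilon> ^ CARD('n)\<close> in absolute value and vanishes off the ball of radius
  \<open>\<epsilon> / 2\<close> around 0; reflection moves that ball to \<open>x\<close>.\<close>

lemma smoothing_le_local_average:
  fixes \<Omega> :: "(real ^ 'n) set" and \<zeta> f :: "real ^ 'n \<Rightarrow> real"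
  assumes \<Omega>: "open \<Omega>" and f: "f \<in> L2_on \<Omega>" and \<epsilon>: "\<epsilon> > 0"
    and M: "0 \<le> M" "AE x in lebesgue. \<bar>\<zeta> x\<bar> \<le> M * indicator (ball 0 (1/2)) x"
  shows "ennreal \<bar>smoothing \<Omega> \<zeta> \<epsilon> f x\<bar> \<le>
    ennreal (M / \<epsilon> ^ CARD('n)) * (\<integral>\<^sup>+z\<in>ball x (\<epsilon> / 2). ennreal \<bar>extend_by_zero \<Omega> f z\<bar> \<partial>lebesgue)"
proof -
  let ?e = "extend_by_zero \<Omega> f" and ?k = "M / \<epsilon> ^ CARD('n)"
  have norm_scaled: "norm (y /\<^sub>R \<epsilon>) < 1/2 \<longleftrightarrow> norm y < \<epsilon> / 2" for y :: "real ^ 'n"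
    using \<epsilon> by (simp add: field_simps)
  have "AE y in lebesgue. \<bar>\<zeta> (0 + inverse \<epsilon> *\<^sub>R y)\<bar> \<le> M * indicator (ball 0 (1/2)) (0 + inverse \<epsilon> *\<^sub>R y)"
    by (rule AE_lebesgue_translate_scale[OF _ M(2)]) (use \<epsilon> in simp)
  then have \<zeta>_bound: "AE y in lebesgue. \<bar>mollifier_scaled \<zeta> \<epsilon> y\<bar> \<le> ?k * indicator (ball 0 (\<epsilon> / 2)) y"
  proof (rule eventually_mono)
    fix y
    assume *: "\<bar>\<zeta> (0 + inverse \<epsilon> *\<^sub>R y)\<bar> \<le> M * indicator (ball 0 (1/2)) (0 + inverse \<epsilon> *\<^sub>R y)"
    have "indicator (ball 0 (1/2)) (0 + inverse \<epsilon> *\<^sub>R y) = (indicator (ball 0 (\<epsilon> / 2)) y :: real)"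
      using norm_scaled[of y] by (simp add: indicator_def)
    with * \<epsilon> show "\<bar>mollifier_scaled \<zeta> \<epsilon> y\<bar> \<le> ?k * indicator (ball 0 (\<epsilon> / 2)) y"
      by (simp add: mollifier_scaled_def abs_divide divide_right_mono)
  qed
  have "ennreal \<bar>smoothing \<Omega> \<zeta> \<epsilon> f x\<bar> \<le> (\<integral>\<^sup>+y. ennreal (norm (?e (x - y) * mollifier_scaled \<zeta> \<epsilon> y)) \<partial>lebesgue)"
  proof (cases "integrable lebesgue (\<lambda>y. ?e (x - y) * mollifier_scaled \<zeta> \<epsilon> y)")
    case True
    then show ?thesis
      using integral_norm_bound_ennreal[OF True] by (simp add: smoothing_def)
  \<comment> \<open>Without integrability the Bochner integral is 0 by default, and the bound is
    trivial.\<close>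
  qed (simp add: smoothing_def not_integrable_integral_eq)
  also have "\<dots> \<le> (\<integral>\<^sup>+y. ennreal ?k * (ennreal \<bar>?e (x - y)\<bar> * indicator (ball x (\<epsilon> / 2)) (x - y)) \<partial>lebesgue)"
  proof (rule nn_integral_mono_AE, use \<zeta>_bound in \<open>rule eventually_mono\<close>)
    fix y
    assume "\<bar>mollifier_scaled \<zeta> \<epsilon> y\<bar> \<le> ?k * indicator (ball 0 (\<epsilon> / 2)) y"
    then have "norm (?e (x - y) * mollifier_scaled \<zeta> \<epsilon> y) \<le> \<bar>?e (x - y)\<bar> * (?k * indicator (ball 0 (\<epsilon> / 2)) y)"
      unfolding real_norm_def abs_mult by (rule mult_left_mono) simp
    also have "\<dots> = ?k * (\<bar>?e (x - y)\<bar> * indicator (ball x (\<epsilon> / 2)) (x - y))"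
      by (simp add: indicator_def dist_norm)
    finally have "ennreal (norm (?e (x - y) * mollifier_scaled \<zeta> \<epsilon> y)) \<le> ennreal \<dots>"
      by (rule ennreal_leI)
    also have "\<dots> = ennreal ?k * (ennreal \<bar>?e (x - y)\<bar> * indicator (ball x (\<epsilon> / 2)) (x - y))"
      using M(1) \<epsilon> by (subst ennreal_mult) (auto simp: indicator_def)
    finally show "ennreal (norm (?e (x - y) * mollifier_scaled \<zeta> \<epsilon> y)) \<le> \<dots>" .
  qed
  also have "\<dots> = (\<integral>\<^sup>+z. ennreal ?k * (ennreal \<bar>?e z\<bar> * indicator (ball x (\<epsilon> / 2)) z) \<partial>lebesgue)"
  proof -
    have "(\<lambda>z. ennreal ?k * (ennreal \<bar>?e z\<bar> * indicator (ball x (\<epsilon> / 2)) z)) \<in> borel_measurable lebesgue"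
      using extend_by_zero_measurable[OF \<Omega> f]
      by (intro borel_measurable_times_ennreal borel_measurable_indicator fmeasurableD[OF lmeasurable_ball]) simp_all
    from nn_integral_lebesgue_translate_scale[of "-1", OF _ this, of x] show ?thesis by simp
  qed
  also have "\<dots> = ennreal ?k * (\<integral>\<^sup>+z\<in>ball x (\<epsilon> / 2). ennreal \<bar>?e z\<bar> \<partial>lebesgue)"
    using extend_by_zero_measurable[OF \<Omega> f]
    by (intro nn_integral_cmult borel_measurable_times_ennreal borel_measurable_indicator fmeasurableD[OF lmeasurable_ball]) simp_all
  finally show ?thesis .
qed

section \<open>The estimate for a general weight\<close>

lemma set_nn_integral_eq_ennreal_set_lebesgue_integral:
  fixes u :: "'a \<Rightarrow> real"
  assumes "set_integrable m S u" "\<And>x. x \<in> S \<Longrightarrow> 0 \<le> u x"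
  shows "(\<integral>\<^sup>+x\<in>S. ennreal (u x) \<partial>m) = ennreal (LINT x:S|m. u x)"
proof -
  have "(\<integral>\<^sup>+x\<in>S. ennreal (u x) \<partial>m) = (\<integral>\<^sup>+x. ennreal (indicator S x *\<^sub>R u x) \<partial>m)"
    by (intro nn_integral_cong) (simp add: indicator_def)
  also have "\<dots> = ennreal (LINT x:S|m. u x)"
    using assms unfolding set_integrable_def set_lebesgue_integral_def
    by (intro nn_integral_eq_integral) (auto simp: indicator_def)
  finally show ?thesis .
qed

text \<open>Treats \<open>\<delta>\<close> and its inverse at once, since only comparability of the
  weight on small balls matters for the constant. The upper bound \<open>B\<close> gives
  integrability of \<open>f\<^sup>2 * w\<close> and does not enter the constant.\<close>

lemma weighted_smoothing_estimate:
  fixes \<Omega> :: "(real ^ 'n) set" and \<zeta> f g w :: "real ^ 'n \<Rightarrow> real" and \<epsilon> M B :: real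
  defines "\<Sigma> \<equiv> inner_region \<Omega> (2 * \<epsilon>)"
  assumes \<Omega>: "open \<Omega>" and \<epsilon>: "\<epsilon> > 0" and f: "f \<in> L2_on \<Omega>"
    and f0: "AE x in lebesgue. x \<in> \<Omega> - \<Sigma> \<longrightarrow> f x = 0"
    and g: "g \<in> L2_per"
    and \<zeta>_meas: "\<zeta> \<in> borel_measurable borel"
    and M: "0 \<le> M" "AE x in lebesgue. \<bar>\<zeta> x\<bar> \<le> M * indicator (ball 0 (1/2)) x"
    and w_meas: "w \<in> borel_measurable borel"
    and w_nonneg: "\<And>x. 0 \<le> w x" and w_le: "\<And>x. x \<in> \<Sigma> \<Longrightarrow> w x \<le> B"
    and w_comp: "\<And>x z. x \<in> \<Sigma> \<Longrightarrow> z \<in> ball x (\<epsilon> / 2) \<Longrightarrow> w x \<le> 2 * w z"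
  shows "set_integrable lebesgue \<Sigma> (\<lambda>x. \<bar>g (x /\<^sub>R \<epsilon>) * smoothing \<Omega> \<zeta> \<epsilon> f x\<bar>\<^sup>2 * w x) \<and>
    sqrt (LINT x : \<Sigma>|lebesgue. \<bar>g (x /\<^sub>R \<epsilon>) * smoothing \<Omega> \<zeta> \<epsilon> f x\<bar>\<^sup>2 * w x) \<le>
      sqrt (2 * 3 ^ CARD('n)) * M * L2_norm unit_cell g * sqrt (LINT x : \<Sigma>|lebesgue. \<bar>f x\<bar>\<^sup>2 * w x)"
proof -
  let ?S = "smoothing \<Omega> \<zeta> \<epsilon> f" and ?e = "extend_by_zero \<Omega> f" and ?d = "CARD('n)"
  define J where "J = (LINT x:\<Sigma>|lebesgue. \<bar>f x\<bar>\<^sup>2 * w x)"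
  define L where "L = (LINT x:unit_cell|lebesgue. (g x)\<^sup>2)"
  define u where "u x = \<bar>g (x /\<^sub>R \<epsilon>) * ?S x\<bar>\<^sup>2 * w x" for x
  have \<Sigma>_borel [measurable]: "\<Sigma> \<in> sets borel"
    using inner_region_borel[OF \<Omega>] by (simp add: \<Sigma>_def)
  have \<Sigma>_leb: "\<Sigma> \<in> sets lebesgue"
    using \<Sigma>_borel by (intro sets_completionI_sets) simp
  have \<Sigma>_sub: "\<Sigma> \<subseteq> \<Omega>"
    by (auto simp: \<Sigma>_def inner_region_def)
  have S_borel [measurable]: "?S \<in> borel_measurable borel"
    by (rule smoothing_borel_measurable[OF \<Omega> f \<zeta>_meas])
  have e_meas: "?e \<in> borel_measurable lebesgue"
    by (rule extend_by_zero_measurable[OF \<Omega> f])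
  obtain h where h_meas [measurable]: "h \<in> borel_measurable borel" and h: "AE x in lborel. ?e x = h x"
    using completion_ex_borel_measurable_real[OF e_meas] by auto
  have w_leb: "w \<in> borel_measurable lebesgue" and S_leb: "?S \<in> borel_measurable lebesgue"
    using w_meas S_borel by (auto intro: measurable_completion)

  have g_meas: "g \<in> borel_measurable lebesgue"
    and g_per: "\<And>z x. (\<And>i. z $ i \<in> \<int>) \<Longrightarrow> g (x + z) = g x"
    and g_int: "set_integrable lebesgue unit_cell (\<lambda>x. (g x)\<^sup>2)"
    using g by (auto simp: L2_per_def L2_on_def)
  have g\<epsilon>_meas: "(\<lambda>x. g (x /\<^sub>R \<epsilon>)) \<in> borel_measurable lebesgue"
    using measurable_compose[OF lebesgue_measurable_translate_scale[of "inverse \<epsilon>" 0] g_meas] \<epsilon> by simp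
  \<comment> \<open>The representative is that of the rescaled function. It need not be periodic, so
    the bound over balls goes back to \<open>g\<close>.\<close>
  obtain g' where g'_meas [measurable]: "g' \<in> borel_measurable borel" and g': "AE x in lborel. g (x /\<^sub>R \<epsilon>) = g' x"
    using completion_ex_borel_measurable_real[OF g\<epsilon>_meas] by auto
  have g_ball: "(\<integral>\<^sup>+x\<in>ball z (\<epsilon> / 2). ennreal ((g' x)\<^sup>2) \<partial>lborel) \<le> ennreal (\<epsilon> ^ ?d * (3 ^ ?d * L))" for z
  proof -
    have "(\<integral>\<^sup>+x\<in>ball z (\<epsilon> / 2). ennreal ((g' x)\<^sup>2) \<partial>lborel) =
        (\<integral>\<^sup>+x\<in>ball z (\<epsilon> / 2). ennreal ((g (x /\<^sub>R \<epsilon>))\<^sup>2) \<partial>lebesgue)"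
      unfolding nn_integral_completion by (rule nn_integral_cong_AE, use g' in \<open>rule eventually_mono\<close>) simp
    also have "\<dots> \<le> ennreal (\<epsilon> ^ ?d) * (3 ^ ?d * (\<integral>\<^sup>+x\<in>unit_cell. ennreal ((g x)\<^sup>2) \<partial>lebesgue))"
      using g_meas g_per \<epsilon> by (intro nn_integral_periodic_scaled_ball_le) auto
    also have "(\<integral>\<^sup>+x\<in>unit_cell. ennreal ((g x)\<^sup>2) \<partial>lebesgue) = ennreal L"
      unfolding L_def by (rule set_nn_integral_eq_ennreal_set_lebesgue_integral[OF g_int]) simp
    also have "ennreal (\<epsilon> ^ ?d) * (3 ^ ?d * ennreal L) = ennreal (\<epsilon> ^ ?d * (3 ^ ?d * L))"
      using \<epsilon> by (simp add: ennreal_mult' flip: ennreal_power)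
    finally show ?thesis .
  qed
  have L0: "0 \<le> L" and J0: "0 \<le> J"
    using w_nonneg by (auto simp: L_def J_def set_lebesgue_integral_def intro!: integral_nonneg_AE)

  \<comment> \<open>Domination by \<open>B\<close> times \<open>f\<^sup>2\<close>. This rules out
    that \<open>J\<close> is merely the default value 0 of a divergent integral. Measurability is
    obtained from \<open>?e\<close>, which agrees with \<open>f\<close> on
    \<open>\<Sigma>\<close>.\<close>
  have fw_int: "set_integrable lebesgue \<Sigma> (\<lambda>x. \<bar>f x\<bar>\<^sup>2 * w x)"
  proof -
    have "integrable lebesgue (\<lambda>x. B *\<^sub>R (indicator \<Omega> x *\<^sub>R (f x)\<^sup>2))"
      using f by (intro integrable_scaleR_right) (auto simp: L2_on_def set_integrable_def)
    moreover have "(\<lambda>x. indicator \<Sigma> x *\<^sub>R (\<bar>?e x\<bar>\<^sup>2 * w x)) \<in> borel_measurable lebesgue"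
      using \<Sigma>_leb e_meas w_leb by (intro borel_measurable_scaleR borel_measurable_indicator borel_measurable_times
        borel_measurable_power borel_measurable_abs)
    moreover have "(\<lambda>x. indicator \<Sigma> x *\<^sub>R (\<bar>?e x\<bar>\<^sup>2 * w x)) = (\<lambda>x. indicator \<Sigma> x *\<^sub>R (\<bar>f x\<bar>\<^sup>2 * w x))"
      using \<Sigma>_sub by (auto simp: fun_eq_iff indicator_def extend_by_zero_def)
    ultimately show ?thesis
      unfolding set_integrable_def
      by (elim Bochner_Integration.integrable_bound, simp, intro AE_I2)
        (use \<Sigma>_sub w_le w_nonneg in \<open>auto simp: indicator_def abs_mult mult.commute[of B] intro!: mult_left_mono order.trans[OF _ abs_ge_self]\<close>)
  qed
  \<comment> \<open>Here the support of \<open>f\<close> enters: the balls around points of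
    \<open>\<Sigma>\<close> may leave \<open>\<Sigma>\<close>, but the extension of \<open>f\<close>
    vanishes almost everywhere there.\<close>
  have h_int: "(\<integral>\<^sup>+z. (ennreal \<bar>h z\<bar>)\<^sup>2 * ennreal (w z) \<partial>lborel) = ennreal J"
  proof -
    have "AE x in lborel. x \<in> \<Omega> - \<Sigma> \<longrightarrow> f x = 0"
      using f0 by (simp add: AE_completion_iff)
    with h have "AE x in lborel. (ennreal \<bar>h x\<bar>)\<^sup>2 * ennreal (w x) = ennreal (\<bar>f x\<bar>\<^sup>2 * w x) * indicator \<Sigma> x"
    proof eventually_elim
      case (elim x)
      then show ?case
        using w_nonneg[of x] \<Sigma>_sub by (auto simp: extend_by_zero_def indicator_def ennreal_mult ennreal_power split: if_splits)
    qed
    then have "(\<integral>\<^sup>+z. (ennreal \<bar>h z\<bar>)\<^sup>2 * ennreal (w z) \<partial>lborel) = (\<integral>\<^sup>+x\<in>\<Sigma>. ennreal (\<bar>f x\<bar>\<^sup>2 * w x) \<partial>lebesgue)"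
      unfolding nn_integral_completion by (rule nn_integral_cong_AE)
    also have "\<dots> = ennreal J"
      unfolding J_def using w_nonneg by (intro set_nn_integral_eq_ennreal_set_lebesgue_integral fw_int) simp
    finally show ?thesis .
  qed
  have S_le: "ennreal \<bar>?S x\<bar> \<le> ennreal (M / \<epsilon> ^ ?d) * (\<integral>\<^sup>+z\<in>ball x (\<epsilon> / 2). ennreal \<bar>h z\<bar> \<partial>lborel)" for x
  proof -
    have "(\<integral>\<^sup>+z\<in>ball x (\<epsilon> / 2). ennreal \<bar>?e z\<bar> \<partial>lebesgue) = (\<integral>\<^sup>+z\<in>ball x (\<epsilon> / 2). ennreal \<bar>h z\<bar> \<partial>lborel)"
      unfolding nn_integral_completion by (rule nn_integral_cong_AE, use h in \<open>rule eventually_mono\<close>) simp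
    with smoothing_le_local_average[OF \<Omega> f \<epsilon> M, of x] show ?thesis by simp
  qed

  have "(\<integral>\<^sup>+x\<in>\<Sigma>. ennreal ((g' x)\<^sup>2) * (ennreal \<bar>?S x\<bar>)\<^sup>2 * ennreal (w x) \<partial>lborel) \<le>
      (ennreal (M / \<epsilon> ^ ?d))\<^sup>2 * ennreal (\<epsilon> ^ ?d) * 2 * ennreal (\<epsilon> ^ ?d * (3 ^ ?d * L)) *
      (\<integral>\<^sup>+z. (ennreal \<bar>h z\<bar>)\<^sup>2 * ennreal (w z) \<partial>lborel)"
  proof (rule weighted_local_average_bound[where r = "\<epsilon> / 2"])
    show "ennreal (w x) \<le> 2 * ennreal (w z)" if "x \<in> \<Sigma>" "z \<in> ball x (\<epsilon> / 2)" for x z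
      using ennreal_leI[OF w_comp[OF that]] by (simp add: ennreal_mult')
    show "emeasure lborel (ball x (\<epsilon> / 2)) \<le> ennreal (\<epsilon> ^ ?d)" for x :: "real ^ 'n"
      using emeasure_lborel_half_ball_le[OF \<epsilon>, of x] by simp
  qed (use w_meas g_ball S_le in simp_all)
  also have "\<dots> = ennreal (2 * 3 ^ ?d * M\<^sup>2 * L * J)"
  proof -
    \<comment> \<open>The powers of \<open>\<epsilon>\<close> cancel: the squared mollifier height
      against the volume of the ball and the Jacobian from the integral of \<open>g\<close>.\<close>
    have "ennreal (2 * 3 ^ ?d * M\<^sup>2 * L * J) = ennreal ((M / \<epsilon> ^ ?d)\<^sup>2 * \<epsilon> ^ ?d * 2 * (\<epsilon> ^ ?d * (3 ^ ?d * L)) * J)"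
      using \<epsilon> by (simp add: field_simps power2_eq_square)
    also have "\<dots> = (ennreal (M / \<epsilon> ^ ?d))\<^sup>2 * ennreal (\<epsilon> ^ ?d) * 2 * ennreal (\<epsilon> ^ ?d * (3 ^ ?d * L)) * ennreal J"
      using \<epsilon> M(1) L0 J0 by (simp add: ennreal_mult ennreal_power)
    finally show ?thesis by (simp add: h_int)
  qed
  also have "(\<integral>\<^sup>+x\<in>\<Sigma>. ennreal ((g' x)\<^sup>2) * (ennreal \<bar>?S x\<bar>)\<^sup>2 * ennreal (w x) \<partial>lborel) =
      (\<integral>\<^sup>+x\<in>\<Sigma>. ennreal (u x) \<partial>lebesgue)"
    unfolding nn_integral_completion u_def
    by (rule nn_integral_cong_AE, use g' in \<open>rule eventually_mono\<close>)
      (use w_nonneg in \<open>simp add: ennreal_mult ennreal_power abs_mult power_mult_distrib\<close>)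
  finally have bound: "(\<integral>\<^sup>+x\<in>\<Sigma>. ennreal (u x) \<partial>lebesgue) \<le> ennreal (2 * 3 ^ ?d * M\<^sup>2 * L * J)" .

  have u0: "0 \<le> u x" for x
    using w_nonneg by (simp add: u_def)
  \<comment> \<open>The bound in \<open>ennreal\<close> is finite, so it yields integrability first
    and only then an inequality between real integrals.\<close>
  have u_int: "set_integrable lebesgue \<Sigma> u"
    unfolding set_integrable_def
  proof (rule integrableI_bounded)
    show "(\<lambda>x. indicator \<Sigma> x *\<^sub>R u x) \<in> borel_measurable lebesgue"
      unfolding u_def using \<Sigma>_leb w_leb S_leb g\<epsilon>_meas
      by (intro borel_measurable_scaleR borel_measurable_indicator borel_measurable_times
        borel_measurable_power borel_measurable_abs)
    have "(\<integral>\<^sup>+x. ennreal (norm (indicator \<Sigma> x *\<^sub>R u x)) \<partial>lebesgue) = (\<integral>\<^sup>+x\<in>\<Sigma>. ennreal (u x) \<partial>lebesgue)"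
      using u0 by (intro nn_integral_cong) (simp add: indicator_def)
    also have "\<dots> < \<infinity>"
      using bound by (rule order.strict_trans1) simp
    finally show "(\<integral>\<^sup>+x. ennreal (norm (indicator \<Sigma> x *\<^sub>R u x)) \<partial>lebesgue) < \<infinity>" .
  qed
  have "ennreal (LINT x:\<Sigma>|lebesgue. u x) \<le> ennreal (2 * 3 ^ ?d * M\<^sup>2 * L * J)"
    using bound set_nn_integral_eq_ennreal_set_lebesgue_integral[OF u_int u0] by simp
  then have "(LINT x:\<Sigma>|lebesgue. u x) \<le> 2 * 3 ^ ?d * M\<^sup>2 * L * J"
    using L0 J0 by (subst (asm) ennreal_le_iff) simp_all
  then have "sqrt (LINT x:\<Sigma>|lebesgue. u x) \<le> sqrt (2 * 3 ^ ?d * M\<^sup>2 * L * J)"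
    by (rule real_sqrt_le_mono)
  also have "\<dots> = sqrt (2 * 3 ^ ?d) * M * sqrt L * sqrt J"
    using M(1) by (simp add: real_sqrt_mult)
  finally show ?thesis
    using u_int by (simp add: u_def[abs_def] L_def J_def L2_norm_def)
qed

section \<open>The two weights\<close>

theorem lemma3p2:
  assumes dim: "CARD('n::finite) \<ge> 3"
  shows "\<exists>C :: ereal \<Rightarrow> real.
    \<forall>(\<Omega> :: (real ^ 'n) set) (\<zeta> :: real ^ 'n \<Rightarrow> real) (\<epsilon> :: real)
      (f :: real ^ 'n \<Rightarrow> real) (g :: real ^ 'n \<Rightarrow> real).
      bounded_lipschitz_domain \<Omega> \<longrightarrow>
      \<zeta> \<in> test_functions (ball 0 (1/2)) \<longrightarrow>
      (LINT x|lebesgue. \<zeta> x) = 1 \<longrightarrow>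
      \<epsilon> > 0 \<longrightarrow>
      f \<in> L2_on \<Omega> \<longrightarrow>
      (AE x in lebesgue. x \<in> \<Omega> - inner_region \<Omega> (2 * \<epsilon>) \<longrightarrow> f x = 0) \<longrightarrow>
      g \<in> L2_per \<longrightarrow>
      (set_integrable lebesgue (inner_region \<Omega> (2 * \<epsilon>))
          (\<lambda>x. \<bar>g (x /\<^sub>R \<epsilon>) * smoothing \<Omega> \<zeta> \<epsilon> f x\<bar>\<^sup>2 * inverse (bdist \<Omega> x)) \<and>
       sqrt (LINT x : inner_region \<Omega> (2 * \<epsilon>)|lebesgue.
            \<bar>g (x /\<^sub>R \<epsilon>) * smoothing \<Omega> \<zeta> \<epsilon> f x\<bar>\<^sup>2 * inverse (bdist \<Omega> x))
         \<le> C (Linf_norm (ball 0 (1/2)) \<zeta>) * L2_norm unit_cell g *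
            sqrt (LINT x : inner_region \<Omega> (2 * \<epsilon>)|lebesgue. \<bar>f x\<bar>\<^sup>2 * inverse (bdist \<Omega> x))) \<and>
      (set_integrable lebesgue (inner_region \<Omega> (2 * \<epsilon>))
          (\<lambda>x. \<bar>g (x /\<^sub>R \<epsilon>) * smoothing \<Omega> \<zeta> \<epsilon> f x\<bar>\<^sup>2 * bdist \<Omega> x) \<and>
       sqrt (LINT x : inner_region \<Omega> (2 * \<epsilon>)|lebesgue.
            \<bar>g (x /\<^sub>R \<epsilon>) * smoothing \<Omega> \<zeta> \<epsilon> f x\<bar>\<^sup>2 * bdist \<Omega> x)
         \<le> C (Linf_norm (ball 0 (1/2)) \<zeta>) * L2_norm unit_cell g *
            sqrt (LINT x : inner_region \<Omega> (2 * \<epsilon>)|lebesgue. \<bar>f x\<bar>\<^sup>2 * bdist \<Omega> x))"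
proof (intro exI[of _ "\<lambda>m. sqrt (2 * 3 ^ CARD('n)) * real_of_ereal m"] allI impI, goal_cases)
  case (1 \<Omega> \<zeta> \<epsilon> f g)
  then have \<Omega>: "open \<Omega>" "bounded \<Omega>"
    by (auto simp: bounded_lipschitz_domain_def)
  have \<zeta>: "\<zeta> \<in> borel_measurable borel" "0 \<le> real_of_ereal (Linf_norm (ball 0 (1/2)) \<zeta>)"
    "AE x in lebesgue. \<bar>\<zeta> x\<bar> \<le> real_of_ereal (Linf_norm (ball 0 (1/2)) \<zeta>) * indicator (ball 0 (1/2)) x"
    using test_function_Linf_bound[OF 1(2) open_ball] 1(3) by simp_all
  obtain B where B: "\<And>x. bdist \<Omega> x \<le> B"
    using bdist_bounded[OF \<Omega>(2)] by blast
  note [measurable] = bdist_borel_measurable[OF \<Omega>(1)]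
  have nonneg: "0 \<le> bdist \<Omega> x" for x
    by (simp add: bdist_def infdist_nonneg)
  have pos: "2 * \<epsilon> < bdist \<Omega> x" if "x \<in> inner_region \<Omega> (2 * \<epsilon>)" for x
    using bdist_comparable(1)[OF 1(4) that centre_in_ball[THEN iffD2]] 1(4) by simp
  \<comment> \<open>Inversion reverses the comparison, so this rests on
    \<open>bdist \<Omega> z \<le> 2 * bdist \<Omega> x\<close>.\<close>
  have inv: "inverse (bdist \<Omega> x) \<le> 2 * inverse (bdist \<Omega> z)"
    if x: "x \<in> inner_region \<Omega> (2 * \<epsilon>)" and z: "z \<in> ball x (\<epsilon> / 2)" for x z
    using bdist_comparable[OF 1(4) x z] 1(4) by (simp add: field_simps)
  show ?case
  \<comment> \<open>The inverse weight is bounded because the distance exceeds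
    \<open>2 * \<epsilon>\<close> on the inner region, the weight \<open>bdist\<close> because
    \<open>\<Omega>\<close> is bounded.\<close>
  proof (intro conjI[OF weighted_smoothing_estimate[where B = "inverse (2 * \<epsilon>)"] weighted_smoothing_estimate[where B = B]])
    show "inverse (bdist \<Omega> x) \<le> inverse (2 * \<epsilon>)" if "x \<in> inner_region \<Omega> (2 * \<epsilon>)" for x
      using pos[OF that] 1(4) by (intro le_imp_inverse_le) auto
    show "bdist \<Omega> x \<le> 2 * bdist \<Omega> z" if "x \<in> inner_region \<Omega> (2 * \<epsilon>)" "z \<in> ball x (\<epsilon> / 2)" for x z
      using bdist_comparable(2)[OF 1(4) that] .
  qed (use 1 \<Omega> \<zeta> B nonneg inv in simp_all)
qed

end
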